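(* Let $n\geqslant 1$ be an integer and let $N(\mathcal{PIO}_n)$ be the set of all nilpotent elements of the monoid $\mathcal{PIO}_n$. Then $$\lvert N(\mathcal{PIO}_n)\rvert=2^{n+2}-n^2-3n-3.$$
   Context: $\Omega_n=\{1,\ldots,n\}$ with its natural order. A partial transformation of $\Omega_n$ is a map $\alpha$ from a subset $\operatorname{Dom}(\alpha)\subseteq\Omega_n$ (possibly empty) into $\Omega_n$, with image $\operatorname{Im}(\alpha)$. Maps are written on the right and composed from left to right: $x(\alpha\beta)=(x\alpha)\beta$, with $\operatorname{Dom}(\alpha\beta)=\{x\in\operatorname{Dom}(\alpha)\mid x\alpha\in\operatorname{Dom}(\beta)\}$. $\alpha$ is order-preserving if $x\leqslant y$ implies $x\alpha\leqslant y\alpha$ for all $x,y\in\operatorname{Dom}(\alpha)$. A subset $I\subseteq\Omega_n$ (possibly empty) is an interval if for all $x,y,z\in\Omega_n$, $x\leqslant y\leqslant z$ and $x,z\in I$ imply $y\in I$. $\mathcal{PIO}_n$ is the monoid, under composition, of all order-preserving partial transformations $\alpha$ of $\Omega_n$ such that $\operatorname{Dom}(\alpha)$ and $\operatorname{Im}(\alpha)$ are both intervals of $\Omega_n$. Its zero is the empty transformation $0_n$. An element $s$ of a semigroup with zero $0$ is nilpotent if $s^k=0$ for some positive integer $k$ (so $0$ itself is nilpotent). *)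

theory Defs
  imports "HOL-Algebra.Group"
begin

definition Omega :: "nat \<Rightarrow> nat set" where
  "Omega n = {1..n}"

definition interval_of :: "nat \<Rightarrow> nat set \<Rightarrow> bool" where
  "interval_of n I \<longleftrightarrow> I \<subseteq> Omega n \<and>
     (\<forall>x\<in>Omega n. \<forall>y\<in>Omega n. \<forall>z\<in>Omega n. x \<le> y \<longrightarrow> y \<le> z \<longrightarrow> x \<in> I \<longrightarrow> z \<in> I \<longrightarrow> y \<in> I)"

text \<open>
  Partial transformations are maps \<open>a :: nat \<rightharpoonup> nat\<close> with \<open>dom a\<close> and \<open>ran a\<close> inside \<open>Omega n\<close>;
  here these inclusions are part of \<^const>\<open>interval_of\<close>.
\<close>

definition order_preserving :: "(nat \<rightharpoonup> nat) \<Rightarrow> bool" where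
  "order_preserving a \<longleftrightarrow> mono_on (dom a) (\<lambda>x. the (a x))"

text \<open>
  Maps act on the right, so the product \<open>a b\<close> is ``first \<open>a\<close>, then \<open>b\<close>'', whereas
  \<open>b \<circ>\<^sub>m a\<close> applies \<open>a\<close> first.
\<close>

definition PIO :: "nat \<Rightarrow> (nat \<rightharpoonup> nat) monoid" where
  "PIO n = \<lparr>carrier = {a. order_preserving a \<and> interval_of n (dom a) \<and> interval_of n (ran a)},
            mult = (\<lambda>a b. b \<circ>\<^sub>m a),
            one = (\<lambda>x. if x \<in> Omega n then Some x else None)\<rparr>"

definition is_zero :: "('a, 'b) monoid_scheme \<Rightarrow> 'a \<Rightarrow> bool" where
  "is_zero S z \<longleftrightarrow> z \<in> carrier S \<and> (\<forall>s\<in>carrier S. z \<otimes>\<^bsub>S\<^esub> s = z \<and> s \<otimes>\<^bsub>S\<^esub> z = z)"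

definition nilpotent_elements :: "('a, 'b) monoid_scheme \<Rightarrow> 'a set" where
  "nilpotent_elements S = {s \<in> carrier S. \<exists>k::nat. k > 0 \<and> is_zero S (s [^]\<^bsub>S\<^esub> k)}"

lemma PIO_is_zero_iff: "is_zero (PIO n) z \<longleftrightarrow> z = Map.empty"
proof
  have e: "Map.empty \<in> carrier (PIO n)"
    by (auto simp: PIO_def order_preserving_def interval_of_def mono_on_def)
  show "z = Map.empty" if "is_zero (PIO n) z"
  proof -
    have "z \<otimes>\<^bsub>PIO n\<^esub> Map.empty = z" using that e by (simp add: is_zero_def)
    then show ?thesis by (auto simp: PIO_def map_comp_def fun_eq_iff split: option.splits)
  qed
  show "is_zero (PIO n) z" if "z = Map.empty"
    using e that by (auto simp: is_zero_def PIO_def)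
qed

lemma PIO_mult_closed:
  assumes a: "a \<in> carrier (PIO n)" and b: "b \<in> carrier (PIO n)"
  shows "a \<otimes>\<^bsub>PIO n\<^esub> b \<in> carrier (PIO n)"
proof -
  have oa: "u \<le> v" if "a x = Some u" "a y = Some v" "x \<le> y" for x y u v
    using a that unfolding PIO_def order_preserving_def mono_on_def by force
  have ob: "u \<le> v" if "b x = Some u" "b y = Some v" "x \<le> y" for x y u v
    using b that unfolding PIO_def order_preserving_def mono_on_def by force
  have ia: "interval_of n (dom a)" "interval_of n (ran a)"
    and ib: "interval_of n (dom b)" "interval_of n (ran b)"
    using a b by (auto simp: PIO_def)
  have conv: "y \<in> I" if "interval_of n I" "x \<in> I" "z \<in> I" "x \<le> y" "y \<le> z" for I x y z
    using that unfolding interval_of_def Omega_def subset_iff atLeastAtMost_iff Ball_def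
    by (meson le_trans)
  have sub: "x \<in> Omega n" if "interval_of n I" "x \<in> I" for I x
    using that by (auto simp: interval_of_def)
  have c: "(b \<circ>\<^sub>m a) x = Some v \<longleftrightarrow> (\<exists>u. a x = Some u \<and> b u = Some v)" for x v
    by (auto simp: map_comp_Some_iff)
  have "order_preserving (b \<circ>\<^sub>m a)"
    unfolding order_preserving_def
  proof (rule mono_onI)
    fix x y assume "x \<in> dom (b \<circ>\<^sub>m a)" "y \<in> dom (b \<circ>\<^sub>m a)" "x \<le> y"
    then obtain u v u' v' where "a x = Some u" "b u = Some u'" "a y = Some v" "b v = Some v'"
      by (auto simp: dom_def c)
    then show "the ((b \<circ>\<^sub>m a) x) \<le> the ((b \<circ>\<^sub>m a) y)"
      using oa[of x u y v] ob[of u u' v v'] \<open>x \<le> y\<close> by simp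
  qed
  moreover have "interval_of n (dom (b \<circ>\<^sub>m a))"
    unfolding interval_of_def
  proof (intro conjI ballI impI subsetI)
    show "x \<in> Omega n" if "x \<in> dom (b \<circ>\<^sub>m a)" for x
    proof -
      have "x \<in> dom a" using that by (auto simp: c)
      then show ?thesis by (rule sub[OF ia(1)])
    qed
    fix x y z assume "x \<le> y" "y \<le> z" "x \<in> dom (b \<circ>\<^sub>m a)" "z \<in> dom (b \<circ>\<^sub>m a)"
    then obtain u v where uv: "a x = Some u" "u \<in> dom b" "a z = Some v" "v \<in> dom b"
      by (auto simp: dom_def c)
    then have "y \<in> dom a" using conv[OF ia(1), of x z y] \<open>x \<le> y\<close> \<open>y \<le> z\<close> by auto
    then obtain w where w: "a y = Some w" by auto
    have "w \<in> dom b"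
      using conv[OF ib(1) uv(2,4), of w] oa[OF uv(1) w] oa[OF w uv(3)] \<open>x \<le> y\<close> \<open>y \<le> z\<close> by simp
    then show "y \<in> dom (b \<circ>\<^sub>m a)" using w by (auto simp: c)
  qed
  moreover have "interval_of n (ran (b \<circ>\<^sub>m a))"
    unfolding interval_of_def
  proof (intro conjI ballI impI subsetI)
    show "x \<in> Omega n" if "x \<in> ran (b \<circ>\<^sub>m a)" for x
    proof -
      have "x \<in> ran b" using that by (auto simp: ran_def c)
      then show ?thesis by (rule sub[OF ib(2)])
    qed
    fix x y z assume le: "x \<le> y" "y \<le> z" and mem: "x \<in> ran (b \<circ>\<^sub>m a)" "z \<in> ran (b \<circ>\<^sub>m a)"
    then obtain p q u v where *: "a p = Some u" "b u = Some x" "a q = Some v" "b v = Some z"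
      by (auto simp: ran_def c)
    then have "y \<in> ran b" using conv[OF ib(2), of x z y] le by (auto simp: ran_def)
    then obtain w where w: "b w = Some y" by (auto simp: ran_def)
    show "y \<in> ran (b \<circ>\<^sub>m a)"
    proof (cases "u \<le> w \<and> w \<le> v")
      case True
      then have "w \<in> ran a" using conv[OF ia(2), of u v w] * by (auto simp: ran_def)
      then show ?thesis using w by (auto simp: ran_def c)
    next
      case False
      then have "y = x \<or> y = z"
        using ob[OF w *(2)] ob[OF *(4) w] le by auto
      then show ?thesis using mem by auto
    qed
  qed
  ultimately show ?thesis by (simp add: PIO_def)
qed

lemma PIO_monoid: "monoid (PIO n)"
proof (rule monoidI)
  show "\<one>\<^bsub>PIO n\<^esub> \<in> carrier (PIO n)"
    by (auto simp: PIO_def order_preserving_def interval_of_def mono_on_def dom_def ran_def)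
  show "x \<otimes>\<^bsub>PIO n\<^esub> y \<otimes>\<^bsub>PIO n\<^esub> z = x \<otimes>\<^bsub>PIO n\<^esub> (y \<otimes>\<^bsub>PIO n\<^esub> z)" for x y z
    by (auto simp: PIO_def map_comp_def fun_eq_iff split: option.splits)
  fix x assume x: "x \<in> carrier (PIO n)"
  then have "dom x \<subseteq> Omega n" "ran x \<subseteq> Omega n" by (auto simp: PIO_def interval_of_def)
  then have d: "p \<in> Omega n \<and> q \<in> Omega n" if "x p = Some q" for p q
    using that by (auto simp: ran_def)
  show "\<one>\<^bsub>PIO n\<^esub> \<otimes>\<^bsub>PIO n\<^esub> x = x"
  proof
    show "(\<one>\<^bsub>PIO n\<^esub> \<otimes>\<^bsub>PIO n\<^esub> x) p = x p" for p
      using d[of p] by (cases "x p") (auto simp: PIO_def map_comp_def)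
  qed
  show "x \<otimes>\<^bsub>PIO n\<^esub> \<one>\<^bsub>PIO n\<^esub> = x"
  proof
    show "(x \<otimes>\<^bsub>PIO n\<^esub> \<one>\<^bsub>PIO n\<^esub>) p = x p" for p
      using d[of p] by (cases "x p") (auto simp: PIO_def map_comp_def)
  qed
qed (rule PIO_mult_closed)

end

theory Submission
  imports Defs
begin

text \<open>
  A nonempty element of \<open>PIO n\<close> is a sequence of values on an interval \<open>{a..b}\<close> in which each step is
  \<open>0\<close> or \<open>1\<close>: an order-preserving map cannot step down, and it cannot skip a value because its image is
  an interval (\<open>PIO_cases\<close>, with converse \<open>map_on_in_PIO\<close>).  Hence the displacement \<open>f x - x\<close>
  changes by \<open>0\<close> or \<open>-1\<close> from each point to the next, and a map that moves some points up and others
  down has a fixed point in between.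

  A fixed point survives in all powers of \<open>f\<close>, so a nilpotent element has none; by the discrete
  intermediate value argument it moves all points up or all points down.  Conversely, under a map that
  moves all points in the same direction, \<open>k\<close> steps move a point by at least \<open>k\<close>, so that no point of
  \<open>{1..n}\<close> survives \<open>n + 1\<close> steps.  The nilpotent elements are therefore the empty map, the nonempty
  rising maps and the nonempty falling maps (\<open>nilpotent_elements_PIO\<close>).  Reversing the order of
  \<open>{1..n}\<close> exchanges the last two classes (\<open>bij_betw_reversal\<close>), so they have the same size.

  A rising map is determined by the largest point \<open>b\<close> of its domain, the value \<open>d\<close> there, and the set
  \<open>S\<close> of the least points of its fibres: the domain begins at the least point of \<open>S\<close>, and the values
  read down from \<open>d\<close>, dropping by one below each further point of \<open>S\<close>.  As the displacement is
  smallest at \<open>b\<close>, the map is rising exactly if \<open>b < d\<close>; the other values are then positive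
  automatically.  So every \<open>d\<close> in \<open>{b<..n}\<close> and every nonempty subset \<open>S\<close> of \<open>{1..b}\<close> occurs, and
  there are \<open>\<Sum>b=1..n. (n - b) * (2 ^ b - 1)\<close> rising maps (\<open>card_rising\<close>).  Twice this sum plus one is
  the claimed number.
\<close>

section \<open>The shape of the nonempty elements\<close>

definition unit_steps :: "nat \<Rightarrow> nat \<Rightarrow> nat \<Rightarrow> (nat \<Rightarrow> nat) \<Rightarrow> bool" where
  "unit_steps n a b h \<longleftrightarrow> 1 \<le> a \<and> a \<le> b \<and> b \<le> n \<and> h ` {a..b} \<subseteq> {1..n} \<and>
     (\<forall>x. a \<le> x \<and> x < b \<longrightarrow> h (Suc x) = h x \<or> h (Suc x) = Suc (h x))"

definition map_on :: "nat \<Rightarrow> nat \<Rightarrow> (nat \<Rightarrow> nat) \<Rightarrow> (nat \<rightharpoonup> nat)" where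
  "map_on a b h = (Some \<circ> h) |` {a..b}"

lemma map_on_eq_Some_iff: "map_on a b h x = Some y \<longleftrightarrow> a \<le> x \<and> x \<le> b \<and> y = h x"
  by (auto simp: map_on_def restrict_map_def)

lemma dom_map_on: "dom (map_on a b h) = {a..b}"
  by (auto simp: map_on_eq_Some_iff dom_def)

lemma ran_map_on: "ran (map_on a b h) = h ` {a..b}"
  by (auto simp: map_on_eq_Some_iff ran_def)

lemma map_on_cong: "(\<And>x. a \<le> x \<Longrightarrow> x \<le> b \<Longrightarrow> h x = g x) \<Longrightarrow> map_on a b h = map_on a b g"
  by (auto simp: map_on_def restrict_map_def fun_eq_iff)

lemma PIO_elementD:
  assumes "f \<in> carrier (PIO n)"
  shows PIO_mono: "\<And>x y u v. f x = Some u \<Longrightarrow> f y = Some v \<Longrightarrow> x \<le> y \<Longrightarrow> u \<le> v"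
    and PIO_bounds: "\<And>x y. f x = Some y \<Longrightarrow> 1 \<le> x \<and> x \<le> n \<and> 1 \<le> y \<and> y \<le> n"
    and PIO_dom_convex: "\<And>x y z. x \<in> dom f \<Longrightarrow> z \<in> dom f \<Longrightarrow> x \<le> y \<Longrightarrow> y \<le> z \<Longrightarrow> y \<in> dom f"
    and PIO_ran_convex: "\<And>x y z. x \<in> ran f \<Longrightarrow> z \<in> ran f \<Longrightarrow> x \<le> y \<Longrightarrow> y \<le> z \<Longrightarrow> y \<in> ran f"
proof -
  have convex: "y \<in> I" if "interval_of n I" "x \<in> I" "z \<in> I" "x \<le> y" "y \<le> z" for I x y z
    using that unfolding interval_of_def Omega_def subset_iff atLeastAtMost_iff Ball_def
    by (meson le_trans)
  have "interval_of n (dom f)" "interval_of n (ran f)"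
    using assms by (auto simp: PIO_def)
  then show "\<And>x y z. x \<in> dom f \<Longrightarrow> z \<in> dom f \<Longrightarrow> x \<le> y \<Longrightarrow> y \<le> z \<Longrightarrow> y \<in> dom f"
    and "\<And>x y z. x \<in> ran f \<Longrightarrow> z \<in> ran f \<Longrightarrow> x \<le> y \<Longrightarrow> y \<le> z \<Longrightarrow> y \<in> ran f"
    using convex by blast+
  show "u \<le> v" if "f x = Some u" "f y = Some v" "x \<le> y" for x y u v
    using assms that unfolding PIO_def order_preserving_def mono_on_def by force
  show "1 \<le> x \<and> x \<le> n \<and> 1 \<le> y \<and> y \<le> n" if "f x = Some y" for x y
  proof -
    have "x \<in> dom f" "y \<in> ran f" "dom f \<subseteq> Omega n" "ran f \<subseteq> Omega n"
      using assms that by (auto simp: PIO_def interval_of_def ran_def)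
    then show ?thesis by (auto simp: Omega_def)
  qed
qed

lemma unit_steps_mono:
  assumes "unit_steps n a b h" "a \<le> x" "x \<le> y" "y \<le> b"
  shows "h x \<le> h y"
  using assms(3,4)
proof (induction y rule: dec_induct)
  case (step m)
  then have "h (Suc m) = h m \<or> h (Suc m) = Suc (h m)"
    using assms(1,2) by (simp add: unit_steps_def)
  with step show ?case by auto
qed simp

text \<open>
  A discrete intermediate value theorem; it makes the image of a map with steps \<open>0\<close> and \<open>1\<close> an interval.
\<close>

lemma unit_steps_image:
  assumes "unit_steps n a b h"
  shows "h ` {a..b} = {h a..h b}"
proof -
  have "h ` {a..y} = {h a..h y}" if "a \<le> y" "y \<le> b" for y
    using that
  proof (induction y rule: dec_induct)
    case (step m)
    have "h (Suc m) = h m \<or> h (Suc m) = Suc (h m)" and "h a \<le> h m"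
      using assms step unit_steps_mono[OF assms, of a m] by (auto simp: unit_steps_def)
    moreover have "{a..Suc m} = insert (Suc m) {a..m}"
      using step by auto
    ultimately show ?case using step by (auto simp: atLeastAtMostSuc_conv)
  qed simp
  then show ?thesis using assms by (auto simp: unit_steps_def)
qed

lemma map_on_in_PIO:
  assumes "unit_steps n a b h"
  shows "map_on a b h \<in> carrier (PIO n)"
proof -
  have "order_preserving (map_on a b h)"
    unfolding order_preserving_def dom_map_on
    by (rule mono_onI) (use unit_steps_mono[OF assms] in \<open>auto simp: map_on_def restrict_map_def\<close>)
  moreover have "interval_of n (dom (map_on a b h))"
    using assms unfolding dom_map_on by (auto simp: interval_of_def Omega_def unit_steps_def)
  moreover have "interval_of n (ran (map_on a b h))"
    using assms unfolding ran_map_on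
    by (auto simp: interval_of_def Omega_def unit_steps_def unit_steps_image[OF assms])
  ultimately show ?thesis by (simp add: PIO_def)
qed

text \<open>
  If \<open>h (x + 1)\<close> exceeded \<open>h x + 1\<close>, then \<open>h x + 1\<close> would be a value, because the image is an interval,
  but monotonicity leaves no point at which it could be taken.
\<close>

lemma PIO_cases:
  assumes f: "f \<in> carrier (PIO n)" and "f \<noteq> Map.empty"
  obtains a b h where "unit_steps n a b h" "f = map_on a b h"
proof -
  define a b h where "a = Min (dom f)" and "b = Max (dom f)" and "h = the \<circ> f"
  have "dom f \<subseteq> {1..n}" using f by (auto simp: PIO_def interval_of_def Omega_def)
  then have fin: "finite (dom f)" by (rule finite_subset) simp
  have ne: "dom f \<noteq> {}" using assms(2) by simp
  have ab: "a \<in> dom f" "b \<in> dom f"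
    unfolding a_def b_def using fin ne by simp_all
  have le: "a \<le> x \<and> x \<le> b" if "x \<in> dom f" for x
    unfolding a_def b_def using fin that by simp
  have dom: "dom f = {a..b}"
  proof
    show "dom f \<subseteq> {a..b}" using le unfolding subset_iff atLeastAtMost_iff by blast
    show "{a..b} \<subseteq> dom f"
      using PIO_dom_convex[OF f ab] unfolding subset_iff atLeastAtMost_iff by blast
  qed
  have fh: "f x = Some (h x)" if "a \<le> x" "x \<le> b" for x
  proof -
    have "x \<in> dom f" using dom that by simp
    then show ?thesis by (auto simp: h_def)
  qed
  have f_eq: "f = map_on a b h"
  proof
    fix x
    show "f x = map_on a b h x"
    proof (cases "x \<in> dom f")
      case True
      then show ?thesis using fh[of x] le[of x] by (simp add: map_on_def restrict_map_def)
    next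
      case False
      then show ?thesis using dom by (auto simp: map_on_def restrict_map_def domIff)
    qed
  qed
  have "h (Suc x) = h x \<or> h (Suc x) = Suc (h x)" if x: "a \<le> x" "x < b" for x
  proof (rule ccontr)
    assume "\<not> ?thesis"
    moreover have fx: "f x = Some (h x)" "f (Suc x) = Some (h (Suc x))"
      using fh[of x] fh[of "Suc x"] x by simp_all
    moreover have "h x \<le> h (Suc x)" using PIO_mono[OF f fx] by simp
    ultimately have gap: "h x < Suc (h x)" "Suc (h x) < h (Suc x)" by auto
    have "h x \<in> ran f" "h (Suc x) \<in> ran f" using fx by (blast intro: ranI)+
    then have "Suc (h x) \<in> ran f"
      by (rule PIO_ran_convex[OF f]) (use gap in simp_all)
    then obtain y where y: "f y = Some (Suc (h x))" by (auto simp: ran_def)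
    show False
      using PIO_mono[OF f y fx(1)] PIO_mono[OF f fx(2) y] gap by linarith
  qed
  moreover have "a \<le> b" using le ab by blast
  moreover from this have "1 \<le> a" "b \<le> n"
    using PIO_bounds[OF f fh[of a]] PIO_bounds[OF f fh[of b]] by simp_all
  moreover have "h ` {a..b} \<subseteq> {1..n}"
  proof (rule image_subsetI)
    fix x assume "x \<in> {a..b}"
    then show "h x \<in> {1..n}" using PIO_bounds[OF f fh[of x]] by simp
  qed
  ultimately have "unit_steps n a b h" unfolding unit_steps_def by blast
  then show ?thesis using f_eq by (rule that)
qed

section \<open>Nilpotent elements move all points in the same direction\<close>

definition rising :: "nat \<Rightarrow> (nat \<rightharpoonup> nat) set" where
  "rising n = {f \<in> carrier (PIO n). f \<noteq> Map.empty \<and> (\<forall>x y. f x = Some y \<longrightarrow> x < y)}"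

definition falling :: "nat \<Rightarrow> (nat \<rightharpoonup> nat) set" where
  "falling n = {f \<in> carrier (PIO n). f \<noteq> Map.empty \<and> (\<forall>x y. f x = Some y \<longrightarrow> y < x)}"

text \<open>
  The position of the first value \<open>h a\<close> relative to \<open>a\<close> decides the direction.  Moving one point to
  the right, the displacement does not grow, so a falling start stays falling; it shrinks by at most
  one, so a rising start cannot change direction without passing through a fixed point.
\<close>

lemma fixed_point_free_cases:
  assumes f: "f \<in> carrier (PIO n)" and fpf: "\<And>x. f x \<noteq> Some x"
  shows "f = Map.empty \<or> f \<in> rising n \<or> f \<in> falling n"
proof (cases "f = Map.empty")
  case False
  then obtain a b h where h: "unit_steps n a b h" and f_eq: "f = map_on a b h"
    using PIO_cases[OF f] by blast
  have steps: "h (Suc x) = h x \<or> h (Suc x) = Suc (h x)" if "a \<le> x" "x < b" for x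
    using h that by (simp add: unit_steps_def)
  have nofix: "h x \<noteq> x" if "a \<le> x" "x \<le> b" for x
    using fpf[of x] that by (simp add: f_eq map_on_eq_Some_iff)
  have up: "x < h x" if "a < h a" "a \<le> x" "x \<le> b" for x
    using that(2,3)
  proof (induction x rule: dec_induct)
    case (step m)
    have "h (Suc m) \<noteq> Suc m" "m < h m" "h m \<le> h (Suc m)"
      using step nofix[of "Suc m"] steps[of m] by auto
    then show ?case by linarith
  qed (use that in simp)
  have down: "h x < x" if "h a < a" "a \<le> x" "x \<le> b" for x
    using that(2,3)
  proof (induction x rule: dec_induct)
    case (step m)
    then show ?case using step steps[of m] by auto
  qed (use that in simp)
  have "h a \<noteq> a" using nofix h by (simp add: unit_steps_def)
  then consider "a < h a" | "h a < a" by linarith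
  then show ?thesis
  proof cases
    case 1
    then have "\<forall>x y. f x = Some y \<longrightarrow> x < y"
      using up unfolding f_eq map_on_eq_Some_iff by blast
    then show ?thesis using f False unfolding rising_def by blast
  next
    case 2
    then have "\<forall>x y. f x = Some y \<longrightarrow> y < x"
      using down unfolding f_eq map_on_eq_Some_iff by blast
    then show ?thesis using f False unfolding falling_def by blast
  qed
qed simp

lemma PIO_pow_Suc:
  "(f [^]\<^bsub>PIO n\<^esub> Suc k) x = Some y \<longleftrightarrow> (\<exists>z. (f [^]\<^bsub>PIO n\<^esub> k) x = Some z \<and> f z = Some y)"
proof -
  have "f [^]\<^bsub>PIO n\<^esub> Suc k = f \<circ>\<^sub>m (f [^]\<^bsub>PIO n\<^esub> k)"
    using monoid.nat_pow_Suc[OF PIO_monoid, of n f k] by (simp only: PIO_def monoid.simps)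
  then show ?thesis by (simp only: map_comp_Some_iff)
qed

lemma PIO_pow_0: "(f [^]\<^bsub>PIO n\<^esub> (0::nat)) x = Some y \<longleftrightarrow> x \<in> Omega n \<and> y = x"
proof -
  have "f [^]\<^bsub>PIO n\<^esub> (0::nat) = (\<lambda>x. if x \<in> Omega n then Some x else None)"
    using monoid.nat_pow_0[OF PIO_monoid, of n f] by (simp only: PIO_def monoid.simps)
  then show ?thesis by auto
qed

lemma rising_pow:
  assumes "\<And>x y. f x = Some y \<Longrightarrow> x < y"
  shows "(f [^]\<^bsub>PIO n\<^esub> k) x = Some y \<Longrightarrow> x + k \<le> y"
proof (induction k arbitrary: y)
  case 0
  then show ?case unfolding PIO_pow_0 by simp
next
  case (Suc k)
  from Suc.prems obtain z where z: "(f [^]\<^bsub>PIO n\<^esub> k) x = Some z" "f z = Some y"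
    unfolding PIO_pow_Suc by blast
  show ?case using Suc.IH[OF z(1)] assms[OF z(2)] by simp
qed

lemma falling_pow:
  assumes "\<And>x y. f x = Some y \<Longrightarrow> y < x"
  shows "(f [^]\<^bsub>PIO n\<^esub> k) x = Some y \<Longrightarrow> y + k \<le> x"
proof (induction k arbitrary: y)
  case 0
  then show ?case unfolding PIO_pow_0 by simp
next
  case (Suc k)
  from Suc.prems obtain z where z: "(f [^]\<^bsub>PIO n\<^esub> k) x = Some z" "f z = Some y"
    unfolding PIO_pow_Suc by blast
  show ?case using Suc.IH[OF z(1)] assms[OF z(2)] by simp
qed

text \<open>
  The power \<open>n + 1\<close> of a rising or falling map vanishes because it would have to move a point of
  \<open>{1..n}\<close> by more than \<open>n\<close>.
\<close>

lemma nilpotent_elements_PIO: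
  "nilpotent_elements (PIO n) = insert Map.empty (rising n \<union> falling n)" (is "?N = ?M")
proof
  interpret monoid "PIO n" by (rule PIO_monoid)
  show "?N \<subseteq> ?M"
  proof
    fix f assume "f \<in> ?N"
    then obtain k where f: "f \<in> carrier (PIO n)" and k: "f [^]\<^bsub>PIO n\<^esub> (k::nat) = Map.empty"
      by (auto simp: nilpotent_elements_def PIO_is_zero_iff)
    have "f x \<noteq> Some x" for x
    proof
      assume fx: "f x = Some x"
      have "x \<in> Omega n" using PIO_bounds[OF f fx] by (simp add: Omega_def)
      then have "(f [^]\<^bsub>PIO n\<^esub> m) x = Some x" for m :: nat
      proof (induction m)
        case 0
        then show ?case unfolding PIO_pow_0 by simp
      next
        case (Suc m)
        then show ?case unfolding PIO_pow_Suc using fx by blast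
      qed
      from k this[of k] show False by simp
    qed
    from fixed_point_free_cases[OF f this] show "f \<in> ?M" by blast
  qed
  show "?M \<subseteq> ?N"
  proof
    fix f assume "f \<in> ?M"
    moreover have "Map.empty \<in> carrier (PIO n)"
      using PIO_is_zero_iff[of n Map.empty] by (simp add: is_zero_def)
    ultimately have f: "f \<in> carrier (PIO n)"
      and dir: "(\<forall>x y. f x = Some y \<longrightarrow> x < y) \<or> (\<forall>x y. f x = Some y \<longrightarrow> y < x)"
      by (auto simp: rising_def falling_def)
    have pow: "f [^]\<^bsub>PIO n\<^esub> Suc n \<in> carrier (PIO n)" using f by (rule nat_pow_closed)
    have "(f [^]\<^bsub>PIO n\<^esub> Suc n) x = None" for x
    proof (cases "(f [^]\<^bsub>PIO n\<^esub> Suc n) x")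
      case (Some y)
      have "x + Suc n \<le> y \<or> y + Suc n \<le> x"
        using dir rising_pow[OF _ Some] falling_pow[OF _ Some] by blast
      with PIO_bounds[OF pow Some] show ?thesis by linarith
    qed
    then have "f [^]\<^bsub>PIO n\<^esub> Suc n = Map.empty" by blast
    then show "f \<in> ?N"
      using f unfolding nilpotent_elements_def PIO_is_zero_iff by blast
  qed
qed

section \<open>Reversing the order exchanges the two directions\<close>

text \<open>
  The conjugate of \<open>f\<close> by the order-reversing permutation \<open>x \<mapsto> n + 1 - x\<close> of \<open>Omega n\<close>.  The
  restriction to \<open>Omega n\<close> keeps out large \<open>x\<close>, which truncated subtraction would send to \<open>0\<close>.
\<close>

definition reversal :: "nat \<Rightarrow> (nat \<rightharpoonup> nat) \<Rightarrow> (nat \<rightharpoonup> nat)" where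
  "reversal n f = (\<lambda>x. if x \<in> Omega n then map_option (\<lambda>y. n + 1 - y) (f (n + 1 - x)) else None)"

lemma reversal_eq_Some_iff:
  assumes "f \<in> carrier (PIO n)"
  shows "reversal n f x = Some y \<longleftrightarrow>
    1 \<le> x \<and> x \<le> n \<and> 1 \<le> y \<and> y \<le> n \<and> f (n + 1 - x) = Some (n + 1 - y)"
  using PIO_bounds[OF assms] by (force simp: reversal_def Omega_def)

text \<open>
  Reading a sequence with steps \<open>0\<close> and \<open>1\<close> backwards and complementing its values gives again such a
  sequence.
\<close>

lemma reversal_in_PIO:
  assumes f: "f \<in> carrier (PIO n)" and "f \<noteq> Map.empty"
  shows "reversal n f \<in> carrier (PIO n)" "reversal n f \<noteq> Map.empty"
proof -
  obtain a b h where h: "unit_steps n a b h" and f_eq: "f = map_on a b h"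
    using PIO_cases[OF assms] by blast
  define g where "g x = n + 1 - h (n + 1 - x)" for x
  have ab: "1 \<le> a" "a \<le> b" "b \<le> n" using h by (auto simp: unit_steps_def)
  have rng: "1 \<le> h x \<and> h x \<le> n" if "a \<le> x" "x \<le> b" for x
    using h that by (auto simp: unit_steps_def image_subset_iff)
  have "g (Suc x) = g x \<or> g (Suc x) = Suc (g x)" if "n + 1 - b \<le> x" "x < n + 1 - a" for x
  proof -
    have m: "a \<le> n - x" "n - x < b" using that ab by linarith+
    have "n + 1 - x = Suc (n - x)" using that ab by linarith
    then have "g x = n + 1 - h (Suc (n - x))" "g (Suc x) = n + 1 - h (n - x)"
      by (simp_all add: g_def)
    moreover have "h (Suc (n - x)) = h (n - x) \<or> h (Suc (n - x)) = Suc (h (n - x))"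
      using h m by (simp add: unit_steps_def)
    moreover have "h (Suc (n - x)) \<le> n" using rng[of "Suc (n - x)"] m by simp
    ultimately show ?thesis by linarith
  qed
  moreover have "1 \<le> g x \<and> g x \<le> n" if "n + 1 - b \<le> x" "x \<le> n + 1 - a" for x
  proof -
    have "a \<le> n + 1 - x" "n + 1 - x \<le> b" using that ab by linarith+
    from rng[OF this] show ?thesis unfolding g_def by linarith
  qed
  ultimately have g: "unit_steps n (n + 1 - b) (n + 1 - a) g"
    using ab by (auto simp: unit_steps_def)
  have eq: "reversal n f = map_on (n + 1 - b) (n + 1 - a) g"
    using ab by (auto simp: reversal_def f_eq map_on_def restrict_map_def fun_eq_iff g_def Omega_def)
  show "reversal n f \<in> carrier (PIO n)"
    unfolding eq by (rule map_on_in_PIO[OF g])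
  have "dom (reversal n f) \<noteq> {}" unfolding eq dom_map_on using ab by simp
  then show "reversal n f \<noteq> Map.empty" by auto
qed

lemma reversal_reversal:
  assumes "f \<in> carrier (PIO n)"
  shows "reversal n (reversal n f) = f"
proof
  fix x
  show "reversal n (reversal n f) x = f x"
  proof (cases "x \<in> Omega n")
    case True
    then have "n + 1 - x \<in> Omega n" "n + 1 - (n + 1 - x) = x" by (auto simp: Omega_def)
    then show ?thesis
      using True PIO_bounds[OF assms, of x] by (cases "f x") (auto simp: reversal_def)
  next
    case False
    then show ?thesis
      using PIO_bounds[OF assms, of x] by (cases "f x") (auto simp: reversal_def Omega_def)
  qed
qed

lemma bij_betw_reversal: "bij_betw (reversal n) (falling n) (rising n)"
proof (rule bij_betw_byWitness[where f' = "reversal n"])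
  show "reversal n ` falling n \<subseteq> rising n"
    by (force simp: falling_def rising_def reversal_in_PIO reversal_eq_Some_iff)
  show "reversal n ` rising n \<subseteq> falling n"
    by (force simp: falling_def rising_def reversal_in_PIO reversal_eq_Some_iff)
qed (auto simp: falling_def rising_def reversal_reversal)

section \<open>Counting the rising elements\<close>

text \<open>
  A code \<open>(b, d, S)\<close> consists of the last point \<open>b\<close> of the domain, the value \<open>d\<close> at \<open>b\<close>, and the
  set \<open>S\<close> of the least elements of the fibres.
\<close>

definition rising_codes :: "nat \<Rightarrow> (nat \<times> nat \<times> nat set) set" where
  "rising_codes n = (SIGMA b:{1..n}. {b<..n} \<times> (Pow {1..b} - {{}}))"

text \<open>
  Between \<open>x\<close> and \<open>b\<close> the map grows by one at every point of \<open>S\<close>, hence the difference below.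
\<close>

definition decode :: "nat \<times> nat \<times> nat set \<Rightarrow> (nat \<rightharpoonup> nat)" where
  "decode = (\<lambda>(b, d, S). map_on (Min S) b (\<lambda>x. d - card (S \<inter> {x<..b})))"

lemma card_Int_greaterThanAtMost_Suc:
  fixes x b :: nat
  assumes "x < b"
  shows "card (S \<inter> {x<..b}) =
    (if Suc x \<in> S then Suc (card (S \<inter> {Suc x<..b})) else card (S \<inter> {Suc x<..b}))"
proof -
  have "{x<..b} = insert (Suc x) {Suc x<..b}" using assms by auto
  then show ?thesis by simp
qed

lemma card_Int_greaterThanAtMost_le: "card (S \<inter> {x<..b}) \<le> b - x" for x b :: nat
  using card_mono[of "{x<..b}" "S \<inter> {x<..b}"] by simp

lemma rising_codesD:
  assumes "(b, d, S) \<in> rising_codes n"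
  shows "1 \<le> b" "b < d" "d \<le> n" "S \<subseteq> {1..b}" "finite S" "Min S \<in> S" "1 \<le> Min S" "Min S \<le> b"
    "\<And>x. x \<in> S \<Longrightarrow> Min S \<le> x"
proof -
  show *: "1 \<le> b" "b < d" "d \<le> n" "S \<subseteq> {1..b}"
    using assms by (auto simp: rising_codes_def)
  show fin: "finite S" using *(4) by (rule finite_subset) simp
  show Min: "Min S \<in> S" using assms fin by (intro Min_in) (auto simp: rising_codes_def)
  show "1 \<le> Min S" "Min S \<le> b" using Min *(4) by auto
  show "\<And>x. x \<in> S \<Longrightarrow> Min S \<le> x" using fin by simp
qed

text \<open>
  Since \<open>S\<close> has at most \<open>b - x\<close> points above \<open>x\<close>, the value at \<open>x\<close> is at least \<open>d - (b - x)\<close>,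
  which exceeds \<open>x\<close> by \<open>b < d\<close>.  This yields the rising property and shows that the subtraction is never
  truncated.
\<close>

lemma decode_in_rising:
  assumes "(b, d, S) \<in> rising_codes n"
  shows "decode (b, d, S) \<in> rising n"
proof -
  note c = rising_codesD[OF assms]
  let ?h = "\<lambda>x. d - card (S \<inter> {x<..b})"
  have up: "x < ?h x" if "x \<le> b" for x
    using card_Int_greaterThanAtMost_le[of S x b] c(2) that by linarith
  have "?h (Suc x) = ?h x \<or> ?h (Suc x) = Suc (?h x)" if "x < b" for x
    using up[of x] that by (auto simp: card_Int_greaterThanAtMost_Suc)
  moreover have "1 \<le> ?h x \<and> ?h x \<le> n" if "x \<le> b" for x
    using up[OF that] c(3) by linarith
  ultimately have "unit_steps n (Min S) b ?h"
    using c by (auto simp: unit_steps_def)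
  then have "map_on (Min S) b ?h \<in> carrier (PIO n)" by (rule map_on_in_PIO)
  moreover have "dom (map_on (Min S) b ?h) \<noteq> {}" unfolding dom_map_on using c by simp
  then have "map_on (Min S) b ?h \<noteq> Map.empty" by (metis dom_empty)
  ultimately show ?thesis
    using up by (simp add: rising_def decode_def map_on_eq_Some_iff)
qed

text \<open>
  The domain returns \<open>b\<close> and \<open>Min S\<close>, the value at \<open>b\<close> returns \<open>d\<close>, and a point above \<open>Min S\<close>
  belongs to \<open>S\<close> if and only if the map grows there, that is, if the number of points of \<open>S\<close> to the
  right changes.
\<close>

lemma inj_on_decode: "inj_on decode (rising_codes n)"
proof (rule inj_onI, clarify)
  fix b d S b' d' S'
  assume C: "(b, d, S) \<in> rising_codes n" "(b', d', S') \<in> rising_codes n"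
    and eq: "decode (b, d, S) = decode (b', d', S')"
  note c = rising_codesD[OF C(1)] and c' = rising_codesD[OF C(2)]
  have "{Min S..b} = {Min S'..b'}"
    using arg_cong[OF eq, of dom] by (simp add: decode_def dom_map_on)
  then have M: "Min S' = Min S" and b: "b' = b" using c c' by auto
  have h: "d - card (S \<inter> {x<..b}) = d' - card (S' \<inter> {x<..b})" if "Min S \<le> x" "x \<le> b" for x
    using fun_cong[OF eq, of x] that by (simp add: decode_def M b map_on_def restrict_map_def)
  have d: "d' = d" using h[of b] c by simp
  have card_eq: "card (S \<inter> {x<..b}) = card (S' \<inter> {x<..b})" if "Min S \<le> x" "x \<le> b" for x
    using h[OF that] card_Int_greaterThanAtMost_le[of S x b]
      card_Int_greaterThanAtMost_le[of S' x b] c(2) unfolding d by linarith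
  have "x \<in> S \<longleftrightarrow> x \<in> S'" for x
  proof (cases "Min S < x \<and> x \<le> b")
    case True
    then obtain m where m: "x = Suc m" "Min S \<le> m" "m < b" by (cases x) auto
    then have "card (S \<inter> {m<..b}) = card (S' \<inter> {m<..b})"
      "card (S \<inter> {Suc m<..b}) = card (S' \<inter> {Suc m<..b})"
      by (auto intro!: card_eq)
    then show ?thesis
      using m by (simp add: card_Int_greaterThanAtMost_Suc split: if_splits)
  next
    case False
    then show ?thesis using c c' M b
      by (metis atLeastAtMost_iff le_neq_implies_less subsetD)
  qed
  then show "b = b' \<and> (d, S) = (d', S')" using b d by auto
qed

text \<open>
  The code of a given map uses its first point and the points at which it grows.  That decoding returns
  the map follows by induction from \<open>b\<close> downwards.
\<close>

lemma rising_subset_decode: "rising n \<subseteq> decode ` rising_codes n"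
proof
  fix f assume f: "f \<in> rising n"
  then obtain a b h where h: "unit_steps n a b h" and f_eq: "f = map_on a b h"
    using PIO_cases[of f n] by (auto simp: rising_def)
  have ab: "1 \<le> a" "a \<le> b" "b \<le> n" using h by (auto simp: unit_steps_def)
  define S where "S = insert a {x \<in> {a<..b}. h x \<noteq> h (x - 1)}"
  have S: "S \<subseteq> {1..b}" "S \<noteq> {}" using ab by (auto simp: S_def)
  have Min: "Min S = a" by (rule Min_eqI) (auto simp: S_def)
  have sum: "h x + card (S \<inter> {x<..b}) = h b" if "a \<le> x" "x \<le> b" for x
    using that(2,1)
  proof (induction x rule: inc_induct)
    case (step m)
    have "h (Suc m) = h m \<or> h (Suc m) = Suc (h m)"
      using h step by (simp add: unit_steps_def)
    moreover have "Suc m \<in> S \<longleftrightarrow> h (Suc m) \<noteq> h m"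
      using step by (auto simp: S_def)
    ultimately show ?case
      using step by (auto simp: card_Int_greaterThanAtMost_Suc)
  qed simp
  have "b < h b" using f ab by (auto simp: rising_def f_eq map_on_eq_Some_iff)
  moreover have "h b \<le> n" using h ab by (auto simp: unit_steps_def image_subset_iff)
  ultimately have "(b, h b, S) \<in> rising_codes n"
    using ab S by (auto simp: rising_codes_def)
  moreover have "f = decode (b, h b, S)"
    unfolding f_eq decode_def prod.case Min
    by (rule map_on_cong) (use sum in \<open>metis add_diff_cancel_right'\<close>)
  ultimately show "f \<in> decode ` rising_codes n" by blast
qed

lemma bij_betw_decode: "bij_betw decode (rising_codes n) (rising n)"
  using inj_on_decode rising_subset_decode decode_in_rising by (fastforce simp: bij_betw_def)

lemma finite_rising: "finite (rising n)"
  using bij_betw_finite[OF bij_betw_decode[of n]] by (simp add: rising_codes_def)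

lemma card_rising: "card (rising n) = (\<Sum>b=1..n. (n - b) * (2 ^ b - 1))"
proof -
  have "card (rising n) = card (rising_codes n)"
    using bij_betw_same_card[OF bij_betw_decode[of n]] by simp
  also have "\<dots> = (\<Sum>b=1..n. (n - b) * (2 ^ b - 1))"
    unfolding rising_codes_def
    by (simp add: card_SigmaI card_cartesian_product card_Diff_subset card_Pow)
  finally show ?thesis .
qed

text \<open>
  Passing from \<open>n\<close> to \<open>n + 1\<close> increases each factor \<open>n - b\<close> by one, which adds a geometric sum.
  The factor \<open>2\<close> avoids a division on the right-hand side.
\<close>

lemma sum_closed_form:
  "2 * int (\<Sum>b=1..n. (n - b) * (2 ^ b - 1)) = 2 ^ (n + 2) - int n ^ 2 - 3 * int n - 4"
proof (induction n)
  case (Suc n)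
  have geo: "int (\<Sum>b=1..m. 2 ^ b - 1) = 2 ^ (m + 1) - 2 - int m" for m :: nat
  proof -
    have "int (\<Sum>b=1..m. 2 ^ b - 1) = (\<Sum>b=1..m. 2 ^ b - 1)"
      by (simp add: of_nat_diff)
    also have "\<dots> = 2 ^ (m + 1) - 2 - int m"
      by (induction m) simp_all
    finally show ?thesis .
  qed
  have "(\<Sum>b=1..Suc n. (Suc n - b) * (2 ^ b - 1)) = (\<Sum>b=1..n. (Suc n - b) * (2 ^ b - 1))"
    by simp
  also have "\<dots> = (\<Sum>b=1..n. (n - b) * (2 ^ b - 1) + (2 ^ b - 1))"
    by (rule sum.cong) (auto simp: Suc_diff_le)
  also have "\<dots> = (\<Sum>b=1..n. (n - b) * (2 ^ b - 1)) + (\<Sum>b=1..n. 2 ^ b - 1)"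
    by (rule sum.distrib)
  finally have "2 * int (\<Sum>b=1..Suc n. (Suc n - b) * (2 ^ b - 1))
      = 2 * int (\<Sum>b=1..n. (n - b) * (2 ^ b - 1)) + 2 * int (\<Sum>b=1..n. 2 ^ b - 1)"
    by simp
  also have "\<dots> = 2 ^ (Suc n + 2) - int (Suc n) ^ 2 - 3 * int (Suc n) - 4"
    unfolding Suc.IH geo by (simp add: power2_eq_square algebra_simps)
  finally show ?case .
qed simp

theorem proposition4:
  fixes n :: nat
  assumes "n \<ge> 1"
  shows "int (card (nilpotent_elements (PIO n))) = 2 ^ (n + 2) - int n ^ 2 - 3 * int n - 3"
proof -
  have disjoint: "rising n \<inter> falling n = {}"
  proof (intro equals0I)
    fix f assume f: "f \<in> rising n \<inter> falling n"
    then obtain x y where "f x = Some y" by (fastforce simp: rising_def)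
    with f have "x < y" "y < x" by (auto simp: rising_def falling_def)
    then show False by simp
  qed
  have finite: "finite (falling n)" and card_falling: "card (falling n) = card (rising n)"
    using bij_betw_finite[OF bij_betw_reversal] bij_betw_same_card[OF bij_betw_reversal]
      finite_rising by blast+
  have "card (nilpotent_elements (PIO n)) = Suc (card (rising n \<union> falling n))"
    unfolding nilpotent_elements_PIO
  proof (rule card_insert_disjoint)
    show "finite (rising n \<union> falling n)" by (simp add: finite finite_rising)
    show "Map.empty \<notin> rising n \<union> falling n" by (simp add: rising_def falling_def)
  qed
  also have "card (rising n \<union> falling n) = 2 * card (rising n)"
    by (simp add: card_Un_disjoint finite finite_rising disjoint card_falling)
  finally have "int (card (nilpotent_elements (PIO n))) = 2 * int (card (rising n)) + 1"
    by simp
  then show ?thesis unfolding card_rising sum_closed_form by simp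
qed

end
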